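(* Let $m\ge2$. For $t\in\{1,\dots,m\}$, let $$W_t:=\sum_{\sigma}\ \prod_{g\in\{1,\dots,m\}}|\sigma^{-1}(g)|!\,,$$ where the sum is over all maps $\sigma:\{1,\dots,t\}\to\{1,\dots,m\}$ with $\sigma(i)\ne i$ for all $i\in\{1,\dots,t\}$, and let $p_t:=(m-1)!\,W_t/(m-1+t)!$. Then, for all $m\ge2$ and $n\ge1$, $$((m-1)!)^n\operatorname{Vol}(\mathcal{Q}_{m,n}\cap \mathcal{D}_{m,n})=\sum_{\pi}\frac{(n)_{|\pi|}}{n^m}\prod_{B\in\pi}p_{|B|}\,,$$ where the sum is over all partitions $\pi$ of $\{1,\dots,m\}$ into nonempty blocks, $|\pi|$ is the number of blocks of $\pi$, and $(n)_\ell:=n(n-1)\cdots(n-\ell+1)$. In particular, for each $m\ge 2$, $((m-1)!)^n\operatorname{Vol}(\mathcal{Q}_{m,n}\cap \mathcal{D}_{m,n})$, as a function of $n\ge 1$, is a polynomial in $1/n$ of degree at most $m-1$.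
   Context: Let $m\ge2$, $n\ge1$ be integers, $M=\{1,\dots,m\}$, $N=\{1,\dots,n\}$. The set $\mathcal{Q}_{m,n}$ (weak relaxation) consists of all $(x,y)\in\mathbb{R}^{m\times n}\times\mathbb{R}^m$ with $\sum_{j\in N}x_{ij}\le n y_i$ for all $i\in M$, $0\le x_{ij}\le 1$ for all $(i,j)\in M\times N$, and $y_i\le1$ for all $i\in M$. The demand constraints define $\mathcal{D}_{m,n}=\{(x,y)\in\mathbb{R}^{m\times n}\times\mathbb{R}^m:\ \sum_{i\in M}x_{ij}=1\ \ \forall j\in N\}$, an affine subspace of dimension $d=(m-1)n+m$. For $K\subset\mathcal{D}_{m,n}$, $\operatorname{Vol}(K)$ denotes the $d$-dimensional Lebesgue measure of the image of $K$ under the coordinate projection $\mathcal{D}_{m,n}\to\mathbb{R}^d$ that deletes the variables $x_{mj}$, $j\in N$ (an affine bijection). *)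

theory Defs
  imports "HOL-Analysis.Analysis" "HOL-Library.Disjoint_Sets" "HOL-Computational_Algebra.Polynomial"
begin

(* Since m and n vary inside the statements, a point (x, y) of R^{m x n} x R^m is encoded as a pair of
   extensional functions on the index sets {1..m} \<times> {1..n} and {1..m}. *)
type_synonym point = "(nat \<times> nat \<Rightarrow> real) \<times> (nat \<Rightarrow> real)"

definition ambient :: "nat \<Rightarrow> nat \<Rightarrow> point set" where
  "ambient m n = (({1..m} \<times> {1..n}) \<rightarrow>\<^sub>E UNIV) \<times> ({1..m} \<rightarrow>\<^sub>E UNIV)"

definition weak_relaxation :: "nat \<Rightarrow> nat \<Rightarrow> point set" where
  "weak_relaxation m n = {(x, y) \<in> ambient m n.
     (\<forall>i\<in>{1..m}. (\<Sum>j\<in>{1..n}. x (i, j)) \<le> real n * y i) \<and>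
     (\<forall>i\<in>{1..m}. \<forall>j\<in>{1..n}. 0 \<le> x (i, j) \<and> x (i, j) \<le> 1) \<and>
     (\<forall>i\<in>{1..m}. y i \<le> 1)}"

definition demand :: "nat \<Rightarrow> nat \<Rightarrow> point set" where
  "demand m n = {(x, y) \<in> ambient m n. \<forall>j\<in>{1..n}. (\<Sum>i\<in>{1..m}. x (i, j)) = 1}"

definition proj :: "nat \<Rightarrow> nat \<Rightarrow> point \<Rightarrow> point" where
  "proj m n = (\<lambda>(x, y). (restrict x ({1..<m} \<times> {1..n}), y))"

(* Lebesgue measure of dimension d = (m - 1) n + m: the completion of the d-fold product of lborel,
   on R^{(m-1) x n} x R^m. *)
definition coord_lebesgue :: "nat \<Rightarrow> nat \<Rightarrow> point measure" where
  "coord_lebesgue m n =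
     completion (Pi\<^sub>M ({1..<m} \<times> {1..n}) (\<lambda>_. lborel) \<Otimes>\<^sub>M Pi\<^sub>M {1..m} (\<lambda>_. lborel))"

(* Only meant for K \<subseteq> demand m n with image of finite measure: 'measure' is 0 on sets that are
   not measurable or have infinite measure. *)
definition Vol :: "nat \<Rightarrow> nat \<Rightarrow> point set \<Rightarrow> real" where
  "Vol m n K = measure (coord_lebesgue m n) (proj m n ` K)"

definition W :: "nat \<Rightarrow> nat \<Rightarrow> nat" where
  "W m t = (\<Sum>\<sigma> \<in> {\<sigma> \<in> {1..t} \<rightarrow>\<^sub>E {1..m}. \<forall>i\<in>{1..t}. \<sigma> i \<noteq> i}.
              \<Prod>g\<in>{1..m}. fact (card {i \<in> {1..t}. \<sigma> i = g}))"

definition p :: "nat \<Rightarrow> nat \<Rightarrow> real" where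
  "p m t = fact (m - 1) * real (W m t) / fact (m - 1 + t)"

definition falling :: "nat \<Rightarrow> nat \<Rightarrow> real" where
  "falling n l = (\<Prod>i<l. real n - real i)"

end

theory Submission
  imports Defs
begin

text \<open>
  Integrating out \<open>y\<close> first, the volume is the integral of \<open>\<Prod>\<^sub>i (1 - (\<Sum>\<^sub>j x\<^sub>i\<^sub>j) / n)\<close> over the \<open>n\<close>-th power of the
  simplex of columns. Each factor equals \<open>(1 / n) \<Sum>\<^sub>j (1 - x\<^sub>i\<^sub>j)\<close>, so expanding the product gives a sum over all maps
  \<open>\<tau>\<close> from rows to columns, and for fixed \<open>\<tau>\<close> the columns separate. Writing \<open>1 - x\<^sub>i\<close> as the sum of
  the other coordinates, the moment \<open>\<Prod>\<^sub>i\<^sub>\<in>\<^sub>B (1 - x\<^sub>i)\<close> becomes a sum of Dirichlet integrals with value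
  \<open>p\<^sub>|\<^sub>B\<^sub>| / (m - 1)!\<close>. Grouping the maps \<open>\<tau>\<close> by their kernel partition yields the falling factorials.
\<close>

section \<open>Functions and their kernel partitions\<close>

lemma falling_Suc: "falling n (Suc l) = falling n l * (real n - real l)"
  by (simp add: falling_def)

text \<open>An injection on \<open>insert a A\<close> is an injection \<open>g\<close> on
  \<open>A\<close> together with a value for \<open>a\<close> outside the image of \<open>A\<close>
  under \<open>g\<close>, which leaves \<open>card C - card A\<close> choices. When
  \<open>card A\<close> exceeds \<open>card C\<close> both sides are 0, since the falling factorial
  then has a vanishing factor.\<close>

lemma card_injections:
  assumes "finite A" "finite C"
  shows "real (card {f \<in> A \<rightarrow>\<^sub>E C. inj_on f A}) = falling (card C) (card A)"
  using assms
proof (induction A arbitrary: C rule: finite_induct)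
  case empty
  then show ?case by (simp add: falling_def)
next
  case (insert a A)
  let ?I = "\<lambda>C. {f \<in> A \<rightarrow>\<^sub>E C. inj_on f A}"
  let ?S = "SIGMA g : ?I C. C - g ` A"
  have fin: "finite (?I C)" using insert by (auto intro: finite_PiE finite_subset[OF _ finite_PiE[of A "\<lambda>_. C"]])
  have bij: "bij_betw (\<lambda>(g, y). g(a := y)) ?S {f \<in> insert a A \<rightarrow>\<^sub>E C. inj_on f (insert a A)}"
  proof (rule bij_betw_byWitness[where f' = "\<lambda>f. (f(a := undefined), f a)"])
    show "\<forall>u\<in>?S. (\<lambda>f. (f(a := undefined), f a)) (case u of (g, y) \<Rightarrow> g(a := y)) = u"
      using insert(2) by (auto simp: fun_eq_iff PiE_def extensional_def)
    show "\<forall>f\<in>{f \<in> insert a A \<rightarrow>\<^sub>E C. inj_on f (insert a A)}.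
            (case (f(a := undefined), f a) of (g, y) \<Rightarrow> g(a := y)) = f"
      by auto
    show "(\<lambda>(g, y). g(a := y)) ` ?S \<subseteq> {f \<in> insert a A \<rightarrow>\<^sub>E C. inj_on f (insert a A)}"
    proof (intro image_subsetI)
      fix u assume "u \<in> ?S"
      then obtain g y where u: "u = (g, y)" and g: "g \<in> A \<rightarrow>\<^sub>E C" "inj_on g A" "y \<in> C" "y \<notin> g ` A"
        by auto
      have upd: "(g(a := y)) i = g i" if "i \<in> A" for i using that insert(2) by auto
      then have "(g(a := y)) ` A = g ` A" by (intro image_cong) simp_all
      moreover have "inj_on (g(a := y)) A" using g by (intro inj_on_fun_updI)
      ultimately have "inj_on (g(a := y)) (insert a A)"
        using g(4) insert(2) by (simp del: fun_upd_apply add: fun_upd_same)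
      moreover have "g(a := y) \<in> insert a A \<rightarrow>\<^sub>E C" using g by (intro PiE_fun_upd)
      ultimately show "(case u of (g, y) \<Rightarrow> g(a := y)) \<in> {f \<in> insert a A \<rightarrow>\<^sub>E C. inj_on f (insert a A)}"
        unfolding u by simp
    qed
    show "(\<lambda>f. (f(a := undefined), f a)) ` {f \<in> insert a A \<rightarrow>\<^sub>E C. inj_on f (insert a A)} \<subseteq> ?S"
    proof (intro image_subsetI)
      fix f assume "f \<in> {f \<in> insert a A \<rightarrow>\<^sub>E C. inj_on f (insert a A)}"
      then have f: "f \<in> insert a A \<rightarrow>\<^sub>E C" "inj_on f A" "f a \<notin> f ` A"
        using insert(2) by auto
      have "f(a := undefined) \<in> A \<rightarrow>\<^sub>E C"
        using f(1) insert(2) by (auto simp: PiE_def extensional_def)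
      moreover have "inj_on (f(a := undefined)) A = inj_on f A"
        by (rule inj_on_cong) (use insert(2) in auto)
      moreover have "f(a := undefined) ` A = f ` A"
        using insert(2) by (intro image_cong) auto
      ultimately show "(f(a := undefined), f a) \<in> ?S"
        using f by (auto simp del: fun_upd_apply)
    qed
  qed
  \<comment> \<open>The existence of \<open>g\<close> forces \<open>card A \<le> card C\<close>, so
    the subtraction of naturals does not truncate.\<close>
  have c: "real (card (C - g ` A)) = real (card C) - real (card A)" if "g \<in> ?I C" for g
  proof -
    have "g ` A \<subseteq> C" "card (g ` A) = card A" using that by (auto simp: card_image)
    moreover from this have "card A \<le> card C" using insert(4) by (metis card_mono)
    ultimately show ?thesis using insert(1,4) by (simp add: card_Diff_subset)
  qed
  have "real (card {f \<in> insert a A \<rightarrow>\<^sub>E C. inj_on f (insert a A)}) = (\<Sum>g\<in>?I C. real (card (C - g ` A)))"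
  proof -
    have "card ?S = (\<Sum>g\<in>?I C. card (C - g ` A))"
      using fin insert(4) by (intro card_SigmaI) auto
    with bij_betw_same_card[OF bij] show ?thesis by (simp only: of_nat_sum[symmetric])
  qed
  also have "\<dots> = (\<Sum>g\<in>?I C. real (card C) - real (card A))" using c by simp
  also have "\<dots> = falling (card C) (card A) * (real (card C) - real (card A))"
    using insert(3)[OF insert(4)] by simp
  finally show ?case using insert(1,2) by (simp add: falling_Suc)
qed

text \<open>The image is taken over \<open>A\<close> and not over a codomain, so only nonempty
  fibres become blocks.\<close>

definition kernel :: "'a set \<Rightarrow> ('a \<Rightarrow> 'b) \<Rightarrow> 'a set set" where
  "kernel A f = (\<lambda>a. {b \<in> A. f b = f a}) ` A"

lemma partition_on_kernel: "partition_on A (kernel A f)"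
  unfolding partition_on_def kernel_def disjoint_def by auto

text \<open>Values that \<open>f\<close> does not attain have empty fibres and contribute
  \<open>h 0 = 1\<close>. Distinct attained values have distinct fibres, so the remaining product
  can be indexed by blocks.\<close>

lemma prod_kernel:
  fixes h :: "nat \<Rightarrow> 'c::comm_monoid_mult"
  assumes "finite A" "finite C" "f \<in> A \<rightarrow> C" "h 0 = 1"
  shows "(\<Prod>c\<in>C. h (card {a \<in> A. f a = c})) = (\<Prod>B\<in>kernel A f. h (card B))"
proof -
  have "(\<Prod>c\<in>C. h (card {a \<in> A. f a = c})) = (\<Prod>c\<in>f ` A. h (card {a \<in> A. f a = c}))"
  proof (rule prod.mono_neutral_right)
    show "\<forall>i\<in>C - f ` A. h (card {a \<in> A. f a = i}) = 1"
    proof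
      fix i assume "i \<in> C - f ` A"
      then have empty: "{a \<in> A. f a = i} = {}" by auto
      show "h (card {a \<in> A. f a = i}) = 1" unfolding empty using assms(4) by simp
    qed
  qed (use assms in auto)
  also have "\<dots> = (\<Prod>B\<in>(\<lambda>c. {a \<in> A. f a = c}) ` (f ` A). h (card B))"
    by (subst prod.reindex) (auto simp: inj_on_def)
  also have "(\<lambda>c. {a \<in> A. f a = c}) ` (f ` A) = kernel A f"
    unfolding kernel_def by (auto simp: image_iff)
  finally show ?thesis .
qed

text \<open>A function with kernel \<open>P\<close> is constant on each block and separates
  different blocks, so it is the same as an injection from \<open>P\<close> to
  \<open>C\<close>.\<close>

lemma card_functions_kernel:
  assumes "finite A" "finite C" and P: "partition_on A P"
  shows "real (card {f \<in> A \<rightarrow>\<^sub>E C. kernel A f = P}) = falling (card C) (card P)"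
proof -
  \<comment> \<open>\<open>blk a\<close> is the unique block containing \<open>a\<close>.
    Precomposing with \<open>blk\<close> turns an injection on blocks into a function on
    \<open>A\<close>; evaluating at a chosen representative of each block goes back.\<close>
  define blk where "blk a = (THE B. B \<in> P \<and> a \<in> B)" for a
  have blk: "blk a = B" if "B \<in> P" "a \<in> B" for a B
    unfolding blk_def using that P by (intro the_equality) (auto simp: partition_on_def disjoint_def)
  have blk_in: "blk a \<in> P" "a \<in> blk a" if "a \<in> A" for a
    using that P blk by (auto simp: partition_on_def)
  have sub: "B \<subseteq> A" if "B \<in> P" for B using that P by (auto simp: partition_on_def)
  have ne: "(SOME a. a \<in> B) \<in> B" if "B \<in> P" for B
    using that P by (metis partition_on_def some_in_eq)
  have finP: "finite P" using P assms(1) finite_elements by blast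
  have bij: "bij_betw (\<lambda>g. \<lambda>a\<in>A. g (blk a)) {g \<in> P \<rightarrow>\<^sub>E C. inj_on g P} {f \<in> A \<rightarrow>\<^sub>E C. kernel A f = P}"
  proof (rule bij_betw_byWitness[where f' = "\<lambda>f. \<lambda>B\<in>P. f (SOME a. a \<in> B)"])
    show "\<forall>g\<in>{g \<in> P \<rightarrow>\<^sub>E C. inj_on g P}. (\<lambda>B\<in>P. (\<lambda>a\<in>A. g (blk a)) (SOME a. a \<in> B)) = g"
    proof
      fix g assume g: "g \<in> {g \<in> P \<rightarrow>\<^sub>E C. inj_on g P}"
      show "(\<lambda>B\<in>P. (\<lambda>a\<in>A. g (blk a)) (SOME a. a \<in> B)) = g"
      proof
        fix B show "(\<lambda>B\<in>P. (\<lambda>a\<in>A. g (blk a)) (SOME a. a \<in> B)) B = g B"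
        proof (cases "B \<in> P")
          case True
          then have "(SOME a. a \<in> B) \<in> A" "blk (SOME a. a \<in> B) = B"
            using ne sub blk by blast+
          then show ?thesis using True by simp
        next
          case False then show ?thesis using g by (auto simp: PiE_def extensional_def)
        qed
      qed
    qed
    \<comment> \<open>Constancy on the blocks of the kernel makes the choice of representative
      irrelevant.\<close>
    have same: "f a = f b" if "kernel A f = P" "B \<in> P" "a \<in> B" "b \<in> B" for f :: "'a \<Rightarrow> 'b" and a b B
    proof -
      have "B \<in> kernel A f" using that by simp
      then show ?thesis using that(3,4) by (auto simp: kernel_def)
    qed
    show "\<forall>f\<in>{f \<in> A \<rightarrow>\<^sub>E C. kernel A f = P}. (\<lambda>a\<in>A. (\<lambda>B\<in>P. f (SOME a. a \<in> B)) (blk a)) = f"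
    proof
      fix f assume f: "f \<in> {f \<in> A \<rightarrow>\<^sub>E C. kernel A f = P}"
      show "(\<lambda>a\<in>A. (\<lambda>B\<in>P. f (SOME a. a \<in> B)) (blk a)) = f"
      proof
        fix a show "(\<lambda>a\<in>A. (\<lambda>B\<in>P. f (SOME a. a \<in> B)) (blk a)) a = f a"
        proof (cases "a \<in> A")
          case True
          note a = blk_in[OF True]
          have "f (SOME b. b \<in> blk a) = f a"
            using f by (intro same[OF _ a(1) ne[OF a(1)] a(2)]) simp
          then show ?thesis using True a by simp
        next
          case False then show ?thesis using f by (auto simp: PiE_def extensional_def)
        qed
      qed
    qed
    show "(\<lambda>g. \<lambda>a\<in>A. g (blk a)) ` {g \<in> P \<rightarrow>\<^sub>E C. inj_on g P} \<subseteq> {f \<in> A \<rightarrow>\<^sub>E C. kernel A f = P}"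
    proof clarify
      fix g assume g: "g \<in> P \<rightarrow>\<^sub>E C" "inj_on g P"
      \<comment> \<open>Injectivity of \<open>g\<close> prevents two blocks from merging into one
        fibre.\<close>
      have cls: "{b \<in> A. (\<lambda>a\<in>A. g (blk a)) b = (\<lambda>a\<in>A. g (blk a)) a} = blk a" if "a \<in> A" for a
      proof -
        have "{b \<in> A. (\<lambda>a\<in>A. g (blk a)) b = (\<lambda>a\<in>A. g (blk a)) a} = {b \<in> A. blk b = blk a}"
          using that blk_in g(2) by (auto dest: inj_onD)
        also have "\<dots> = blk a" using that blk_in blk sub by blast
        finally show ?thesis .
      qed
      have "kernel A (\<lambda>a\<in>A. g (blk a)) = blk ` A"
        unfolding kernel_def using cls by (intro image_cong) auto
      also have "\<dots> = P"
      proof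
        show "P \<subseteq> blk ` A"
        proof
          fix B assume B: "B \<in> P"
          then have "blk (SOME a. a \<in> B) = B" "(SOME a. a \<in> B) \<in> A" using ne blk sub by blast+
          then show "B \<in> blk ` A" by (metis imageI)
        qed
      qed (use blk_in in auto)
      finally show "(\<lambda>a\<in>A. g (blk a)) \<in> A \<rightarrow>\<^sub>E C \<and> kernel A (\<lambda>a\<in>A. g (blk a)) = P"
        using g blk_in by auto
    qed
    show "(\<lambda>f. \<lambda>B\<in>P. f (SOME a. a \<in> B)) ` {f \<in> A \<rightarrow>\<^sub>E C. kernel A f = P} \<subseteq> {g \<in> P \<rightarrow>\<^sub>E C. inj_on g P}"
    proof clarify
      fix f assume f: "f \<in> A \<rightarrow>\<^sub>E C" "P = kernel A f"
      let ?r = "\<lambda>B. SOME a. a \<in> B"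
      have inA: "?r B \<in> A" if "B \<in> P" for B using ne sub that by blast
      have "inj_on (\<lambda>B\<in>P. f (?r B)) P"
      proof (rule inj_onI)
        fix B B' assume B: "B \<in> P" "B' \<in> P" and "(\<lambda>B\<in>P. f (?r B)) B = (\<lambda>B\<in>P. f (?r B)) B'"
        then have eq: "f (?r B) = f (?r B')" by simp
        have cl: "D = {b \<in> A. f b = f (?r D)}" if "D \<in> P" for D
        proof -
          have "D \<in> kernel A f" using that f(2) by simp
          then obtain a where "a \<in> A" "D = {b \<in> A. f b = f a}"
            unfolding kernel_def by blast
          then show ?thesis using ne[OF that] by auto
        qed
        show "B = B'" using cl[OF B(1)] cl[OF B(2)] eq by simp
      qed
      then show "(\<lambda>B\<in>kernel A f. f (?r B)) \<in> kernel A f \<rightarrow>\<^sub>E C \<and> inj_on (\<lambda>B\<in>kernel A f. f (?r B)) (kernel A f)"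
        using f inA by auto
    qed
  qed
  show ?thesis
    using bij_betw_same_card[OF bij] card_injections[OF finP assms(2)] by simp
qed

text \<open>The summand depends only on the kernel of \<open>f\<close>, so grouping by kernels gives
  each partition the weight computed in \<open>card_functions_kernel\<close>.\<close>

lemma sum_functions_by_kernel:
  fixes h :: "nat \<Rightarrow> real"
  assumes "finite A" "finite C" "h 0 = 1"
  shows "(\<Sum>f\<in>A \<rightarrow>\<^sub>E C. \<Prod>c\<in>C. h (card {a \<in> A. f a = c})) =
         (\<Sum>P | partition_on A P. falling (card C) (card P) * (\<Prod>B\<in>P. h (card B)))"
proof -
  have fin: "finite (A \<rightarrow>\<^sub>E C)" using assms by (simp add: finite_PiE)
  have finP: "finite {P. partition_on A P}" using assms(1) by (rule finitely_many_partition_on)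
  have "(\<Sum>f\<in>A \<rightarrow>\<^sub>E C. \<Prod>c\<in>C. h (card {a \<in> A. f a = c})) = (\<Sum>f\<in>A \<rightarrow>\<^sub>E C. \<Prod>B\<in>kernel A f. h (card B))"
    using assms by (intro sum.cong prod_kernel) auto
  also have "\<dots> = (\<Sum>P | partition_on A P. \<Sum>f | f \<in> A \<rightarrow>\<^sub>E C \<and> kernel A f = P. \<Prod>B\<in>kernel A f. h (card B))"
    using fin finP by (intro sum.group[symmetric]) (auto simp: partition_on_kernel)
  also have "\<dots> = (\<Sum>P | partition_on A P. falling (card C) (card P) * (\<Prod>B\<in>P. h (card B)))"
    using assms by (intro sum.cong) (simp_all add: card_functions_kernel[symmetric])
  finally show ?thesis .
qed

text \<open>Relabel by a permutation of \<^term>\<open>{1..m}\<close> that maps \<^term>\<open>B\<close> onto \<^term>\<open>{1..card B}\<close>.\<close>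

lemma W_card:
  assumes "B \<subseteq> {1..m}"
  shows "real (W m (card B)) =
    (\<Sum>\<sigma>\<in>Pi\<^sub>E B (\<lambda>i. {1..m} - {i}). \<Prod>g\<in>{1..m}. fact (card {i \<in> B. \<sigma> i = g}))"
proof -
  let ?t = "card B" and ?M = "{1..m}"
  have finB: "finite B" using assms finite_subset by blast
  have "card B \<le> m" using assms card_mono[of ?M B] by simp
  then have sub: "{1..?t} \<subseteq> ?M" by auto
  obtain h1 where h1: "bij_betw h1 B {1..?t}"
    using finB finite_same_card_bij[of B "{1..?t}"] by auto
  have "card (?M - B) = card (?M - {1..?t})"
    using finB assms sub by (simp add: card_Diff_subset)
  \<comment> \<open>The maps take values in all of \<open>{1..m}\<close>, so the bijection on
    \<open>B\<close> has to be extended to the complement before it can act on values as well as on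
    arguments.\<close>
  then obtain h2 where h2: "bij_betw h2 (?M - B) (?M - {1..?t})"
    using finite_same_card_bij[of "?M - B" "?M - {1..?t}"] by auto
  define h where "h i = (if i \<in> B then h1 i else h2 i)" for i
  have "bij_betw h (B \<union> (?M - B)) ({1..?t} \<union> (?M - {1..?t}))"
  proof (rule bij_betw_combine)
    show "bij_betw h B {1..?t}" using h1 by (simp add: h_def cong: bij_betw_cong)
    have "bij_betw h (?M - B) (?M - {1..?t}) \<longleftrightarrow> bij_betw h2 (?M - B) (?M - {1..?t})"
      by (rule bij_betw_cong) (simp add: h_def)
    then show "bij_betw h (?M - B) (?M - {1..?t})" using h2 by simp
  qed auto
  then have h: "bij_betw h ?M ?M" using assms sub by (simp add: Un_absorb1)
  have hB: "bij_betw h B {1..?t}" using h1 by (simp add: h_def cong: bij_betw_cong)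
  define k where "k = inv_into ?M h"
  have kh: "k (h i) = i" if "i \<in> ?M" for i
    unfolding k_def using h that by (simp add: bij_betw_inv_into_left)
  have hk: "h (k i) = i" if "i \<in> ?M" for i
    unfolding k_def using h that by (simp add: bij_betw_inv_into_right)
  have hM: "h i \<in> ?M" if "i \<in> ?M" for i using h that by (auto simp: bij_betw_def)
  have kM: "k i \<in> ?M" if "i \<in> ?M" for i
    using bij_betw_inv_into[OF h] that unfolding k_def by (auto simp: bij_betw_def)
  have hB': "h i \<in> {1..?t}" if "i \<in> B" for i using hB that by (auto simp: bij_betw_def)
  have kB: "k i \<in> B" if "i \<in> {1..?t}" for i
  proof -
    have "i \<in> h ` B" using bij_betw_imp_surj_on[OF hB] that by simp
    then obtain b where "b \<in> B" "h b = i" by auto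
    then show ?thesis using kh assms by auto
  qed
  have BM: "i \<in> ?M" if "i \<in> B" for i using that assms by auto
  have tM: "i \<in> ?M" if "i \<in> {1..?t}" for i using that sub by auto
  have "(\<Sum>\<sigma>\<in>Pi\<^sub>E B (\<lambda>i. ?M - {i}). \<Prod>g\<in>?M. fact (card {i \<in> B. \<sigma> i = g})) =
     (\<Sum>\<sigma> \<in> {\<sigma> \<in> {1..?t} \<rightarrow>\<^sub>E ?M. \<forall>i\<in>{1..?t}. \<sigma> i \<noteq> i}.
              \<Prod>g\<in>?M. fact (card {i \<in> {1..?t}. \<sigma> i = g}) :: real)"
  \<comment> \<open>The reindexing is conjugation by \<open>h\<close>, which preserves the condition
    \<open>\<sigma> i \<noteq> i\<close>.\<close>
  proof (rule sum.reindex_bij_witness[where i = "\<lambda>\<sigma>. \<lambda>i\<in>B. k (\<sigma> (h i))"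
          and j = "\<lambda>\<sigma>. \<lambda>i\<in>{1..?t}. h (\<sigma> (k i))"])
    fix \<sigma> assume s: "\<sigma> \<in> Pi\<^sub>E B (\<lambda>i. ?M - {i})"
    have sM: "\<sigma> i \<in> ?M" "\<sigma> i \<noteq> i" if "i \<in> B" for i using s that by (auto simp: PiE_def Pi_def)
    show "(\<lambda>i\<in>B. k ((\<lambda>i\<in>{1..?t}. h (\<sigma> (k i))) (h i))) = \<sigma>"
    proof
      fix i show "(\<lambda>i\<in>B. k ((\<lambda>i\<in>{1..?t}. h (\<sigma> (k i))) (h i))) i = \<sigma> i"
      proof (cases "i \<in> B")
        case True
        then show ?thesis using hB'[OF True] kh[OF BM[OF True]] kh[OF sM(1)[OF True]] by simp
      next
        case False then show ?thesis using s by (auto simp: PiE_def extensional_def)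
      qed
    qed
    have "h (\<sigma> (k i)) \<noteq> i" if "i \<in> {1..?t}" for i
    proof
      assume "h (\<sigma> (k i)) = i"
      then have "\<sigma> (k i) = k i" using kh[OF sM(1)[OF kB[OF that]]] by simp
      then show False using sM(2)[OF kB[OF that]] by simp
    qed
    moreover have "h (\<sigma> (k i)) \<in> ?M" if "i \<in> {1..?t}" for i
      using hM sM kB that by blast
    ultimately show "(\<lambda>i\<in>{1..?t}. h (\<sigma> (k i))) \<in> {\<sigma> \<in> {1..?t} \<rightarrow>\<^sub>E ?M. \<forall>i\<in>{1..?t}. \<sigma> i \<noteq> i}"
      by (simp add: PiE_def Pi_def)
    \<comment> \<open>\<open>h\<close> carries the fibre of \<open>\<sigma>\<close> over
      \<open>g\<close> onto the fibre of the conjugate over \<open>h g\<close>. The fibre sizes are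
      thus only permuted, and the product of factorials is unchanged.\<close>
    have "(\<Prod>g\<in>?M. fact (card {i \<in> B. \<sigma> i = g})) =
        (\<Prod>g\<in>?M. fact (card {i \<in> {1..?t}. h (\<sigma> (k i)) = h g}) :: real)"
    proof (rule prod.cong[OF refl])
      fix g assume g: "g \<in> ?M"
      have "{i \<in> {1..?t}. h (\<sigma> (k i)) = h g} = h ` {i \<in> B. \<sigma> i = g}"
      proof (intro subset_antisym subsetI)
        fix i assume "i \<in> {i \<in> {1..?t}. h (\<sigma> (k i)) = h g}"
        then have i: "i \<in> {1..?t}" "h (\<sigma> (k i)) = h g" by auto
        then have "\<sigma> (k i) = g" using kh[OF g] kh[OF sM(1)[OF kB[OF i(1)]]] by simp
        then show "i \<in> h ` {i \<in> B. \<sigma> i = g}"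
          using kB[OF i(1)] hk[OF tM[OF i(1)]] by (intro image_eqI[of _ _ "k i"]) auto
      qed (use hB' kh BM in auto)
      moreover have "inj_on h {i \<in> B. \<sigma> i = g}"
        by (rule inj_on_subset[OF bij_betw_imp_inj_on[OF hB]]) auto
      ultimately show "fact (card {i \<in> B. \<sigma> i = g}) = (fact (card {i \<in> {1..?t}. h (\<sigma> (k i)) = h g}) :: real)"
        by (simp add: card_image)
    qed
    also have "\<dots> = (\<Prod>g\<in>?M. fact (card {i \<in> {1..?t}. h (\<sigma> (k i)) = g}))"
      by (rule prod.reindex_bij_betw[OF h])
    also have "\<dots> = (\<Prod>g\<in>?M. fact (card {i \<in> {1..?t}. (\<lambda>i\<in>{1..?t}. h (\<sigma> (k i))) i = g}))"
    proof -
      have "{i \<in> {1..?t}. h (\<sigma> (k i)) = g} = {i \<in> {1..?t}. (\<lambda>i\<in>{1..?t}. h (\<sigma> (k i))) i = g}" for g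
        by auto
      then show ?thesis by simp
    qed
    finally show "(\<Prod>g\<in>?M. fact (card {i \<in> {1..?t}. (\<lambda>i\<in>{1..?t}. h (\<sigma> (k i))) i = g})) =
      (\<Prod>g\<in>?M. fact (card {i \<in> B. \<sigma> i = g}) :: real)" by simp
  next
    fix \<sigma> assume s: "\<sigma> \<in> {\<sigma> \<in> {1..?t} \<rightarrow>\<^sub>E ?M. \<forall>i\<in>{1..?t}. \<sigma> i \<noteq> i}"
    have sM: "\<sigma> i \<in> ?M" "\<sigma> i \<noteq> i" if "i \<in> {1..?t}" for i using s that by (auto simp: PiE_def Pi_def)
    show "(\<lambda>i\<in>{1..?t}. h ((\<lambda>i\<in>B. k (\<sigma> (h i))) (k i))) = \<sigma>"
    proof
      fix i show "(\<lambda>i\<in>{1..?t}. h ((\<lambda>i\<in>B. k (\<sigma> (h i))) (k i))) i = \<sigma> i"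
      proof (cases "i \<in> {1..?t}")
        case True
        then show ?thesis using kB[OF True] hk[OF tM[OF True]] hk[OF sM(1)[OF True]] by simp
      next
        case False then show ?thesis using s by (auto simp: PiE_def extensional_def)
      qed
    qed
    have "k (\<sigma> (h i)) \<noteq> i" if "i \<in> B" for i
    proof
      assume "k (\<sigma> (h i)) = i"
      then have "\<sigma> (h i) = h i" using hk[OF sM(1)[OF hB'[OF that]]] by simp
      then show False using sM(2)[OF hB'[OF that]] by simp
    qed
    moreover have "k (\<sigma> (h i)) \<in> ?M" if "i \<in> B" for i
      using kM sM hB' that by blast
    ultimately show "(\<lambda>i\<in>B. k (\<sigma> (h i))) \<in> Pi\<^sub>E B (\<lambda>i. ?M - {i})"
      by (simp add: PiE_def Pi_def)
  qed
  then show ?thesis by (simp add: W_def)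
qed

text \<open>This supplies the hypothesis \<open>h 0 = 1\<close> of
  \<open>sum_functions_by_kernel\<close> for \<open>h = p m\<close>: columns chosen by no row
  contribute the factor 1.\<close>

lemma p_0: "p m 0 = 1"
  by (simp add: p_def W_def)

section \<open>Dirichlet integrals\<close>

text \<open>This is the Beta integral on \<open>[0, s]\<close>. Integration by parts trades an
  exponent of \<open>t\<close> for one of \<open>s - t\<close>, hence the induction on
  \<open>a\<close> with \<open>b\<close> arbitrary.\<close>

lemma nn_integral_beta_scaled:
  fixes s :: real
  assumes "0 \<le> s"
  shows "(\<integral>\<^sup>+t. ennreal (if 0 \<le> t \<and> t \<le> s then t ^ a * (s - t) ^ b else 0) \<partial>lborel) =
    ennreal (fact a * fact b * s ^ (a + b + 1) / fact (a + b + 1))"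
proof -
  have "((\<lambda>t. t ^ a * (s - t) ^ b) has_integral fact a * fact b * s ^ (a + b + 1) / fact (a + b + 1)) {0..s}"
  proof (induction a arbitrary: b)
    case 0
    have "((\<lambda>t. (b+1) * (s - t) ^ b) has_integral (- ((s - s) ^ (b+1)) - (- ((s - 0) ^ (b+1))))) {0..s}"
      using assms
      by (intro fundamental_theorem_of_calculus)
         (auto intro!: derivative_eq_intros simp: has_real_derivative_iff_has_vector_derivative[symmetric] algebra_simps
            simp del: power_Suc)
    then have "((\<lambda>t. real (b+1) * (s - t) ^ b / (real b + 1)) has_integral
        (- ((s - s) ^ (b+1)) - (- ((s - 0) ^ (b+1)))) / (real b + 1)) {0..s}"
      by (rule has_integral_divide)
    moreover have "(- ((s - s) ^ (b+1)) - (- ((s - 0) ^ (b+1)))) = s ^ (b+1)" by simp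
    moreover have "real (b+1) * z / (real b + 1) = z" for z
    proof -
      have "real b + 1 \<noteq> 0" by linarith
      from nonzero_mult_div_cancel_left[OF this] show ?thesis by (simp only: of_nat_add of_nat_1)
    qed
    ultimately have "((\<lambda>t. (s - t) ^ b) has_integral s ^ (b+1) / (real b + 1)) {0..s}"
      by (simp only:)
    moreover have "fact 0 * fact b * s ^ (0 + b + 1) / fact (0 + b + 1) = s ^ (b + 1) / (real b + 1)"
      by (simp add: divide_simps)
    ultimately show ?case by (simp only: power_0 mult_1)
  next
    case (Suc a)
    have nz: "real (b+1) \<noteq> 0" by simp
    \<comment> \<open>The integrand is the derivative of \<open>t ^ (a+1) * (s - t) ^ (b+1)\<close>,
      which vanishes at both ends. Solving for its second term reduces the claim to the induction
      hypothesis at \<open>b + 1\<close>.\<close>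
    have D: "((\<lambda>t. (a+1) * (t ^ a * (s - t) ^ (b+1)) - (b+1) * (t ^ (a+1) * (s - t) ^ b))
       has_integral (s ^ (a+1) * (s - s) ^ (b+1) - 0 ^ (a+1) * (s - 0) ^ (b+1))) {0..s}"
      using assms
      by (intro fundamental_theorem_of_calculus)
         (auto intro!: derivative_eq_intros simp: has_real_derivative_iff_has_vector_derivative[symmetric] algebra_simps
            simp del: power_Suc)
    have "((\<lambda>t. ((a+1) * (t ^ a * (s - t) ^ (b+1)) - ((a+1) * (t ^ a * (s - t) ^ (b+1)) - (b+1) * (t ^ (a+1) * (s - t) ^ b))) / (b+1))
       has_integral ((a+1) * (fact a * fact (b+1) * s ^ (a + (b+1) + 1) / fact (a + (b+1) + 1)) - (s ^ (a+1) * (s - s) ^ (b+1) - 0 ^ (a+1) * (s - 0) ^ (b+1))) / (b+1)) {0..s}"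
      by (intro has_integral_divide has_integral_diff has_integral_mult_right D Suc)
    moreover have "((a+1) * (fact a * fact (b+1) * s ^ (a + (b+1) + 1) / fact (a + (b+1) + 1)) - (s ^ (a+1) * (s - s) ^ (b+1) - 0 ^ (a+1) * (s - 0) ^ (b+1))) / (b+1)
      = fact (Suc a) * fact b * s ^ (Suc a + b + 1) / fact (Suc a + b + 1)"
    proof -
      have "Suc a + b + 1 = a + (b+1) + 1" by simp
      moreover have "fact (b+1) = real (b+1) * fact b" "fact (Suc a) = real (a+1) * fact a" by simp_all
      moreover have "s ^ (a+1) * (s - s) ^ (b+1) - 0 ^ (a+1) * (s - 0) ^ (b+1) = 0" by simp
      moreover have "(A * (u * (B * v) * S / F) - 0) / B = (A * u) * v * S / F" if "B \<noteq> 0" for A B u v S F :: real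
        using that by simp
      ultimately show ?thesis using nz by (simp only: simp_thms not_False_eq_True)
    qed
    moreover have "((a+1) * (t ^ a * (s - t) ^ (b+1)) - ((a+1) * (t ^ a * (s - t) ^ (b+1)) - (b+1) * (t ^ (a+1) * (s - t) ^ b))) / (b+1) = t ^ Suc a * (s - t) ^ b" for t
    proof -
      have "(X - (X - B * Z)) / B = Z" if "B \<noteq> 0" for X B Z :: real
        using that by simp
      then show ?thesis using nz by (simp only: Suc_eq_plus1 simp_thms not_False_eq_True)
    qed
    ultimately show ?case by (simp only:)
  qed
  then have "((\<lambda>t. if t \<in> {0..s} then t ^ a * (s - t) ^ b else 0) has_integral
      fact a * fact b * s ^ (a + b + 1) / fact (a + b + 1)) UNIV"
    by (simp only: has_integral_restrict_UNIV)
  then have "((\<lambda>t. if 0 \<le> t \<and> t \<le> s then t ^ a * (s - t) ^ b else 0) has_integral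
      fact a * fact b * s ^ (a + b + 1) / fact (a + b + 1)) UNIV"
    by simp
  then show ?thesis
    by (intro nn_integral_has_integral_lborel) auto
qed

interpretation lborel_prod: product_sigma_finite "\<lambda>_. lborel :: real measure"
  by (rule product_sigma_finite.intro) (rule lborel.sigma_finite_measure_axioms)

text \<open>Fixing one coordinate \<open>y\<close> leaves a simplex of size \<open>s - y\<close>, so
  the size must vary in the induction. The inner integral is a constant times a power of
  \<open>s - y\<close>, and the outer one is a Beta integral. The exponent \<open>b\<close> belongs
  to the slack \<open>s - sum x I\<close>.\<close>

lemma nn_integral_dirichlet:
  fixes s :: real
  assumes "finite I" "0 \<le> s"
  shows "(\<integral>\<^sup>+x. ennreal (if (\<forall>i\<in>I. 0 \<le> x i) \<and> sum x I \<le> s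
        then (\<Prod>i\<in>I. x i ^ a i) * (s - sum x I) ^ b else 0) \<partial>Pi\<^sub>M I (\<lambda>_. lborel)) =
    ennreal ((\<Prod>i\<in>I. fact (a i)) * fact b * s ^ (card I + sum a I + b) / fact (card I + sum a I + b))"
  using assms
proof (induction I arbitrary: s rule: finite_induct)
  case empty
  then show ?case by (simp add: PiM_empty nn_integral_count_space_finite)
next
  case (insert k I)
  define F where "F I s x = (if (\<forall>i\<in>I. 0 \<le> x i) \<and> sum x I \<le> s
        then (\<Prod>i\<in>I. x i ^ a i) * (s - sum x I) ^ b else (0::real))" for I s x
  define N where "N = card I + sum a I + b"
  \<comment> \<open>The induction hypothesis at size \<open>s - y\<close> reads
    \<open>K * (s - y) ^ N\<close>.\<close>
  define K where "K = (\<Prod>i\<in>I. fact (a i)) * fact b / (fact N :: real)"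
  have [measurable]: "F J s \<in> borel_measurable (Pi\<^sub>M J (\<lambda>_. lborel))" if "finite J" for J s
    unfolding F_def using that by measurable
  have Fn: "0 \<le> F J s x" for J s x
    unfolding F_def by (auto intro!: mult_nonneg_nonneg prod_nonneg)
  \<comment> \<open>For nonnegative \<open>x\<close> the bound on the total sum already forces
    \<open>y \<le> s\<close>, so this bound can be attached to the factor in
    \<open>y\<close>.\<close>
  have split: "ennreal (F (insert k I) s (x(k := y))) =
      ennreal (if 0 \<le> y \<and> y \<le> s then y ^ a k else 0) * ennreal (F I (s - y) x)" for x y
  proof -
    have 1: "sum (x(k := y)) I = sum x I" using insert by (intro sum.cong) auto
    have 2: "(\<Prod>i\<in>I. (x(k := y)) i ^ a i) = (\<Prod>i\<in>I. x i ^ a i)" using insert by (intro prod.cong) auto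
    have 3: "(\<forall>i\<in>I. 0 \<le> (x(k := y)) i) = (\<forall>i\<in>I. 0 \<le> x i)" using insert by auto
    have "F (insert k I) s (x(k := y)) = (if 0 \<le> y \<and> y \<le> s then y ^ a k else 0) * F I (s - y) x"
    proof (cases "(\<forall>i\<in>I. 0 \<le> x i) \<and> 0 \<le> y")
      case True
      then have "0 \<le> sum x I" by (auto intro: sum_nonneg)
      then show ?thesis using True insert(1,2) 1 2 3
        by (auto simp: F_def algebra_simps)
    next
      case False
      then show ?thesis using insert(1,2) 3 by (auto simp: F_def)
    qed
    then show ?thesis using Fn by (simp add: ennreal_mult)
  qed
  have Fm: "(\<lambda>x. ennreal (F (insert k I) s x)) \<in> borel_measurable (Pi\<^sub>M (insert k I) (\<lambda>_. lborel))"
    using insert by simp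
  have "(\<integral>\<^sup>+x. ennreal (F (insert k I) s x) \<partial>Pi\<^sub>M (insert k I) (\<lambda>_. lborel)) =
    (\<integral>\<^sup>+y. (\<integral>\<^sup>+x. ennreal (F (insert k I) s (x(k := y))) \<partial>Pi\<^sub>M I (\<lambda>_. lborel)) \<partial>lborel)"
    using insert Fm by (intro lborel_prod.product_nn_integral_insert_rev) auto
  also have "\<dots> = (\<integral>\<^sup>+y. ennreal K * ennreal (if 0 \<le> y \<and> y \<le> s then y ^ a k * (s - y) ^ N else 0) \<partial>lborel)"
  proof (rule nn_integral_cong)
    fix y :: real
    have "(\<integral>\<^sup>+x. ennreal (F (insert k I) s (x(k := y))) \<partial>Pi\<^sub>M I (\<lambda>_. lborel)) =
        ennreal (if 0 \<le> y \<and> y \<le> s then y ^ a k else 0) * (\<integral>\<^sup>+x. ennreal (F I (s - y) x) \<partial>Pi\<^sub>M I (\<lambda>_. lborel))"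
      unfolding split using insert(1) by (intro nn_integral_cmult) auto
    also have "\<dots> = ennreal K * ennreal (if 0 \<le> y \<and> y \<le> s then y ^ a k * (s - y) ^ N else 0)"
    proof (cases "0 \<le> y \<and> y \<le> s")
      \<comment> \<open>Here \<open>s - y\<close> is nonnegative, as the induction hypothesis
        requires; for other \<open>y\<close> both sides are 0.\<close>
      case True
      then have "(\<integral>\<^sup>+x. ennreal (F I (s - y) x) \<partial>Pi\<^sub>M I (\<lambda>_. lborel)) = ennreal (K * (s - y) ^ N)"
        using insert(3)[of "s - y"] by (simp add: F_def K_def N_def)
      moreover have "0 \<le> K" by (auto simp: K_def intro!: divide_nonneg_nonneg mult_nonneg_nonneg prod_nonneg)
      ultimately show ?thesis using True by (simp add: ennreal_mult[symmetric] algebra_simps)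
    qed auto
    finally show "(\<integral>\<^sup>+x. ennreal (F (insert k I) s (x(k := y))) \<partial>Pi\<^sub>M I (\<lambda>_. lborel)) =
      ennreal K * ennreal (if 0 \<le> y \<and> y \<le> s then y ^ a k * (s - y) ^ N else 0)" .
  qed
  also have "\<dots> = ennreal K * ennreal (fact (a k) * fact N * s ^ (a k + N + 1) / fact (a k + N + 1))"
    using insert(4) by (simp add: nn_integral_cmult nn_integral_beta_scaled del: fact_Suc power_Suc)
  also have "\<dots> = ennreal (K * (fact (a k) * fact N * s ^ (a k + N + 1) / fact (a k + N + 1)))"
    using insert(4) by (intro ennreal_mult[symmetric]) (auto simp: K_def intro!: divide_nonneg_nonneg mult_nonneg_nonneg prod_nonneg)
  also have "K * (fact (a k) * fact N * s ^ (a k + N + 1) / fact (a k + N + 1)) =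
    (\<Prod>i\<in>insert k I. fact (a i)) * fact b * s ^ (card (insert k I) + sum a (insert k I) + b)
     / fact (card (insert k I) + sum a (insert k I) + b)"
  proof -
    have "card (insert k I) + sum a (insert k I) + b = a k + N + 1" using insert(1,2) by (simp add: N_def)
    then show ?thesis unfolding K_def using insert(1,2)
      by (simp only:) (simp del: fact_Suc power_Suc)
  qed
  finally show ?case unfolding F_def .
qed

section \<open>Renaming coordinates and separating columns in product Lebesgue measure\<close>

lemma distr_PiM_lborel_reindex:
  fixes h :: "'a \<Rightarrow> 'b"
  assumes "finite I" "inj_on h I"
  shows "distr (Pi\<^sub>M (h ` I) (\<lambda>_. lborel :: real measure)) (Pi\<^sub>M I (\<lambda>_. lborel)) (\<lambda>x. \<lambda>i\<in>I. x (h i)) =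
     Pi\<^sub>M I (\<lambda>_. lborel)"
proof (rule lborel_prod.PiM_eqI)
  have [measurable]: "(\<lambda>x. \<lambda>i\<in>I. x (h i)) \<in> Pi\<^sub>M (h ` I) (\<lambda>_. lborel :: real measure) \<rightarrow>\<^sub>M Pi\<^sub>M I (\<lambda>_. lborel)"
    by (intro measurable_restrict measurable_component_singleton) auto
  fix A assume A: "\<And>i. i \<in> I \<Longrightarrow> A i \<in> sets (lborel :: real measure)"
  let ?k = "inv_into I h"
  have k: "?k (h i) = i" if "i \<in> I" for i using assms that by simp
  have "(\<lambda>x. \<lambda>i\<in>I. x (h i)) -` Pi\<^sub>E I A \<inter> space (Pi\<^sub>M (h ` I) (\<lambda>_. lborel)) = Pi\<^sub>E (h ` I) (\<lambda>j. A (?k j))"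
    using k by (auto simp: space_PiM PiE_def Pi_def)
  moreover have "Pi\<^sub>E I A \<in> sets (Pi\<^sub>M I (\<lambda>_. lborel))"
    using A assms by (intro sets_PiM_I_finite) auto
  moreover have "emeasure (Pi\<^sub>M (h ` I) (\<lambda>_. lborel)) (Pi\<^sub>E (h ` I) (\<lambda>j. A (?k j))) =
     (\<Prod>j\<in>h ` I. emeasure lborel (A (?k j)))"
    using assms A k by (intro lborel_prod.emeasure_PiM) auto
  moreover have "\<dots> = (\<Prod>i\<in>I. emeasure lborel (A i))"
    using assms k by (simp add: prod.reindex)
  ultimately show "emeasure (distr (Pi\<^sub>M (h ` I) (\<lambda>_. lborel)) (Pi\<^sub>M I (\<lambda>_. lborel)) (\<lambda>x. \<lambda>i\<in>I. x (h i))) (Pi\<^sub>E I A) =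
     (\<Prod>i\<in>I. emeasure lborel (A i))"
    by (subst emeasure_distr) auto
qed (use assms in auto)

text \<open>Tonelli's theorem peels off one column at a time: the factor of column \<open>k\<close>
  sees only the coordinates in \<open>I \<times> {k}\<close>, and all other factors only those in
  \<open>I \<times> J\<close>.\<close>

lemma nn_integral_prod_columns:
  fixes f :: "'b \<Rightarrow> ('a \<Rightarrow> real) \<Rightarrow> ennreal"
  assumes "finite I" "finite J"
    and f: "\<And>j. j \<in> J \<Longrightarrow> f j \<in> borel_measurable (Pi\<^sub>M I (\<lambda>_. lborel))"
  shows "(\<integral>\<^sup>+x. (\<Prod>j\<in>J. f j (\<lambda>i\<in>I. x (i, j))) \<partial>Pi\<^sub>M (I \<times> J) (\<lambda>_. lborel)) =
    (\<Prod>j\<in>J. \<integral>\<^sup>+z. f j z \<partial>Pi\<^sub>M I (\<lambda>_. lborel))"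
  using assms(2) f
proof (induction J rule: finite_induct)
  case empty
  then show ?case by (simp add: PiM_empty nn_integral_count_space_finite)
next
  case (insert k J)
  let ?P = "\<lambda>S. Pi\<^sub>M S (\<lambda>_. lborel :: real measure)"
  have [measurable]: "f k \<in> borel_measurable (?P I)" using insert by simp
  have mk: "(\<lambda>x. \<lambda>i\<in>I. x (i, j)) \<in> ?P S \<rightarrow>\<^sub>M ?P I" if "I \<times> {j} \<subseteq> S" for S j
    using that by (intro measurable_restrict measurable_component_singleton) auto
  have mf: "(\<lambda>x. f j (\<lambda>i\<in>I. x (i, j))) \<in> borel_measurable (?P S)" if "I \<times> {j} \<subseteq> S" "j \<in> insert k J" for S j
    using measurable_compose[OF mk[OF that(1)] insert(4)[OF that(2)]] .
  have U: "I \<times> insert k J = I \<times> {k} \<union> I \<times> J" by auto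
  have "(\<integral>\<^sup>+x. (\<Prod>j\<in>insert k J. f j (\<lambda>i\<in>I. x (i, j))) \<partial>?P (I \<times> insert k J)) =
     (\<integral>\<^sup>+x. (\<integral>\<^sup>+y. (\<Prod>j\<in>insert k J. f j (\<lambda>i\<in>I. merge (I \<times> {k}) (I \<times> J) (x, y) (i, j))) \<partial>?P (I \<times> J)) \<partial>?P (I \<times> {k}))"
    unfolding U using assms(1) insert(1,2)
    by (intro lborel_prod.product_nn_integral_fold) (auto intro!: borel_measurable_prod_ennreal borel_measurable_times_ennreal mf)
  also have "\<dots> = (\<integral>\<^sup>+x. (\<integral>\<^sup>+y. f k (\<lambda>i\<in>I. x (i, k)) * (\<Prod>j\<in>J. f j (\<lambda>i\<in>I. y (i, j))) \<partial>?P (I \<times> J)) \<partial>?P (I \<times> {k}))"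
  proof (intro nn_integral_cong)
    fix x y :: "'a \<times> 'b \<Rightarrow> real"
    have "(\<lambda>i\<in>I. merge (I \<times> {k}) (I \<times> J) (x, y) (i, k)) = (\<lambda>i\<in>I. x (i, k))"
      by (auto simp: merge_def)
    moreover have "(\<lambda>i\<in>I. merge (I \<times> {k}) (I \<times> J) (x, y) (i, j)) = (\<lambda>i\<in>I. y (i, j))" if "j \<in> J" for j
      using that insert(2) by (auto simp: merge_def fun_eq_iff)
    ultimately show "(\<Prod>j\<in>insert k J. f j (\<lambda>i\<in>I. merge (I \<times> {k}) (I \<times> J) (x, y) (i, j))) =
       f k (\<lambda>i\<in>I. x (i, k)) * (\<Prod>j\<in>J. f j (\<lambda>i\<in>I. y (i, j)))"
      using insert(1,2) by simp
  qed
  also have "\<dots> = (\<integral>\<^sup>+x. f k (\<lambda>i\<in>I. x (i, k)) * (\<integral>\<^sup>+y. (\<Prod>j\<in>J. f j (\<lambda>i\<in>I. y (i, j))) \<partial>?P (I \<times> J)) \<partial>?P (I \<times> {k}))"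
    by (intro nn_integral_cong nn_integral_cmult borel_measurable_prod_ennreal mf) auto
  also have "\<dots> = (\<integral>\<^sup>+x. f k (\<lambda>i\<in>I. x (i, k)) \<partial>?P (I \<times> {k})) * (\<integral>\<^sup>+y. (\<Prod>j\<in>J. f j (\<lambda>i\<in>I. y (i, j))) \<partial>?P (I \<times> J))"
    by (intro nn_integral_multc mf) auto
  also have "(\<integral>\<^sup>+x. f k (\<lambda>i\<in>I. x (i, k)) \<partial>?P (I \<times> {k})) = (\<integral>\<^sup>+z. f k z \<partial>?P I)"
  proof -
    \<comment> \<open>A single column is a copy of \<open>I\<close>; renaming its coordinates
      preserves the measure.\<close>
    have "I \<times> {k} = (\<lambda>i. (i, k)) ` I" by auto
    then have "?P I = distr (?P (I \<times> {k})) (?P I) (\<lambda>x. \<lambda>i\<in>I. x (i, k))"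
      using distr_PiM_lborel_reindex[of I "\<lambda>i. (i, k)"] assms(1) by (simp add: inj_on_def)
    then have "(\<integral>\<^sup>+z. f k z \<partial>?P I) = (\<integral>\<^sup>+z. f k z \<partial>distr (?P (I \<times> {k})) (?P I) (\<lambda>x. \<lambda>i\<in>I. x (i, k)))"
      by simp
    also have "\<dots> = (\<integral>\<^sup>+x. f k (\<lambda>i\<in>I. x (i, k)) \<partial>?P (I \<times> {k}))"
      by (intro nn_integral_distr mk) auto
    finally show ?thesis by simp
  qed
  also have "(\<integral>\<^sup>+y. (\<Prod>j\<in>J. f j (\<lambda>i\<in>I. y (i, j))) \<partial>?P (I \<times> J)) = (\<Prod>j\<in>J. \<integral>\<^sup>+z. f j z \<partial>?P I)"
    by (rule insert(3)) (use insert(4) in auto)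
  finally show ?case using insert(1,2) by simp
qed

section \<open>Moments of the simplex\<close>

text \<open>The coordinate \<open>z m\<close> deleted by the projection is restored from the demand constraint.\<close>

definition bary :: "nat \<Rightarrow> (nat \<Rightarrow> real) \<Rightarrow> nat \<Rightarrow> real" where
  "bary m z i = (if i = m then 1 - (\<Sum>k\<in>{1..<m}. z k) else z i)"

definition in_simplex :: "nat \<Rightarrow> (nat \<Rightarrow> real) \<Rightarrow> bool" where
  "in_simplex m z \<longleftrightarrow> (\<forall>i\<in>{1..m}. 0 \<le> bary m z i)"

text \<open>Stated with \<^term>\<open>Suc 0\<close> because the simplifier rewrites \<open>1\<close> to it.\<close>

lemma atLeastAtMost_insert_last: "1 \<le> m \<Longrightarrow> {Suc 0..m} = insert m {Suc 0..<m}"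
  by auto

lemma sum_bary: "1 \<le> m \<Longrightarrow> (\<Sum>i\<in>{1..m}. bary m z i) = 1"
  by (simp add: atLeastAtMost_insert_last bary_def)

lemma in_simplex_iff:
  assumes "1 \<le> m"
  shows "in_simplex m z \<longleftrightarrow> (\<forall>i\<in>{1..<m}. 0 \<le> z i) \<and> sum z {1..<m} \<le> 1"
  using assms by (auto simp: in_simplex_def bary_def atLeastAtMost_insert_last)

lemma bary_le_1:
  assumes "1 \<le> m" "in_simplex m z" "i \<in> {1..m}"
  shows "bary m z i \<le> 1"
  using member_le_sum[of i "{1..m}" "bary m z"] assms sum_bary[of m z] by (auto simp: in_simplex_def)

lemma measurable_bary [measurable]:
  assumes "i \<in> {1..m}"
  shows "(\<lambda>z. bary m z i) \<in> borel_measurable (Pi\<^sub>M {1..<m} (\<lambda>_. lborel))"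
proof (cases "i = m")
  case False
  then have "i \<in> {1..<m}" using assms by auto
  then show ?thesis using False by (simp add: bary_def)
qed (simp add: bary_def)

lemma measurable_in_simplex [measurable]:
  "Measurable.pred (Pi\<^sub>M {1..<m} (\<lambda>_. lborel)) (in_simplex m)"
  unfolding in_simplex_def by measurable

text \<open>The extension by zero turns an integral over the simplex into one over the whole space.
  It applies to empty \<open>B\<close> too, where the function is the indicator of the
  simplex.\<close>

definition simplex_moment :: "nat \<Rightarrow> nat set \<Rightarrow> (nat \<Rightarrow> real) \<Rightarrow> real" where
  "simplex_moment m B z = (if in_simplex m z then \<Prod>i\<in>B. 1 - bary m z i else 0)"

lemma simplex_moment_nonneg:
  assumes "1 \<le> m" "B \<subseteq> {1..m}"
  shows "0 \<le> simplex_moment m B z"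
proof -
  have "bary m z i \<le> 1" if "in_simplex m z" "i \<in> B" for i
    using bary_le_1[OF assms(1) that(1)] that(2) assms(2) by blast
  then show ?thesis unfolding simplex_moment_def by (auto intro!: prod_nonneg)
qed

lemma measurable_simplex_moment:
  assumes "B \<subseteq> {1..m}"
  shows "simplex_moment m B \<in> borel_measurable (Pi\<^sub>M {1..<m} (\<lambda>_. lborel))"
proof -
  have [measurable]: "(\<lambda>z. \<Prod>i\<in>B. 1 - bary m z i) \<in> borel_measurable (Pi\<^sub>M {1..<m} (\<lambda>_. lborel))"
    using assms by (intro borel_measurable_prod borel_measurable_diff borel_measurable_const measurable_bary) auto
  show ?thesis unfolding simplex_moment_def by measurable
qed

lemma sum_card_fibres:
  assumes "finite A" "finite C" "f \<in> A \<rightarrow> C"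
  shows "(\<Sum>c\<in>C. card {a \<in> A. f a = c}) = card A"
  using sum.group[of A C f "\<lambda>_. 1::nat"] assms by auto

lemma prod_compose_fibres:
  fixes y :: "'b \<Rightarrow> 'c::comm_monoid_mult"
  assumes "finite A" "finite C" "f \<in> A \<rightarrow> C"
  shows "(\<Prod>a\<in>A. y (f a)) = (\<Prod>c\<in>C. y c ^ card {a \<in> A. f a = c})"
proof -
  have "(\<Prod>a\<in>A. y (f a)) = (\<Prod>c\<in>C. \<Prod>a | a \<in> A \<and> f a = c. y (f a))"
    using assms by (intro prod.group[symmetric]) auto
  also have "\<dots> = (\<Prod>c\<in>C. y c ^ card {a \<in> A. f a = c})"
    by (intro prod.cong refl) simp
  finally show ?thesis .
qed

text \<open>Choosing a term \<open>g \<noteq> i\<close> from each factor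
  \<open>1 - bary m z i\<close> produces exactly the maps counted by \<open>W\<close>, with fibre
  sizes as exponents. Each monomial is a Dirichlet integral, and \<open>W_card\<close> shows that
  only the size of \<open>B\<close> matters.\<close>

lemma nn_integral_simplex_moment:
  assumes m: "1 \<le> m" and B: "B \<subseteq> {1..m}"
  shows "(\<integral>\<^sup>+z. ennreal (simplex_moment m B z) \<partial>Pi\<^sub>M {1..<m} (\<lambda>_. lborel)) =
    ennreal (p m (card B) / fact (m - 1))"
proof -
  let ?M = "{1..m}" and ?S = "Pi\<^sub>E B (\<lambda>i. {1..m} - {i})"
  define c where "c \<sigma> g = card {i \<in> B. \<sigma> i = g}" for \<sigma> :: "nat \<Rightarrow> nat" and g
  have finB: "finite B" using B finite_subset by blast
  have finS: "finite ?S" using finB by (intro finite_PiE) auto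
  have S: "\<sigma> \<in> B \<rightarrow> ?M" if "\<sigma> \<in> ?S" for \<sigma> using that by (auto simp: PiE_def Pi_def)
  \<comment> \<open>This is the monomial of \<open>\<sigma>\<close> in the form of
    \<open>nn_integral_dirichlet\<close> with \<open>s = 1\<close>: the restored coordinate
    \<open>m\<close> is the slack, so \<open>c \<sigma> m\<close> is the exponent
    \<open>b\<close>.\<close>
  define D where "D \<sigma> z = (if (\<forall>i\<in>{1..<m}. 0 \<le> z i) \<and> sum z {1..<m} \<le> 1
      then (\<Prod>g\<in>{1..<m}. z g ^ c \<sigma> g) * (1 - sum z {1..<m}) ^ c \<sigma> m else 0)" for \<sigma> and z :: "nat \<Rightarrow> real"
  have Dn: "0 \<le> D \<sigma> z" for \<sigma> z
    unfolding D_def by (auto intro!: mult_nonneg_nonneg prod_nonneg)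
  have [measurable]: "D \<sigma> \<in> borel_measurable (Pi\<^sub>M {1..<m} (\<lambda>_. lborel))" for \<sigma>
    unfolding D_def by measurable
  have expand: "simplex_moment m B z = (\<Sum>\<sigma>\<in>?S. D \<sigma> z)" for z
  proof (cases "in_simplex m z")
    case True
    have "1 - bary m z i = (\<Sum>g\<in>?M - {i}. bary m z g)" if "i \<in> B" for i
      using that B sum_bary[OF m, of z] by (subst sum_diff1) auto
    then have "simplex_moment m B z = (\<Prod>i\<in>B. \<Sum>g\<in>?M - {i}. bary m z g)"
      using True by (simp add: simplex_moment_def)
    also have "\<dots> = (\<Sum>\<sigma>\<in>?S. \<Prod>i\<in>B. bary m z (\<sigma> i))"
      using finB by (intro prod_sum_PiE) auto
    also have "\<dots> = (\<Sum>\<sigma>\<in>?S. \<Prod>g\<in>?M. bary m z g ^ c \<sigma> g)"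
      unfolding c_def using finB S by (intro sum.cong prod_compose_fibres) auto
    also have "\<dots> = (\<Sum>\<sigma>\<in>?S. D \<sigma> z)"
    proof (rule sum.cong[OF refl])
      fix \<sigma>
      have "(\<Prod>g\<in>?M. bary m z g ^ c \<sigma> g) = (\<Prod>g\<in>{1..<m}. bary m z g ^ c \<sigma> g) * bary m z m ^ c \<sigma> m"
        using m by (simp add: atLeastAtMost_insert_last mult.commute)
      also have "\<dots> = D \<sigma> z"
        using True m by (simp add: D_def in_simplex_iff bary_def)
      finally show "(\<Prod>g\<in>?M. bary m z g ^ c \<sigma> g) = D \<sigma> z" .
    qed
    finally show ?thesis .
  next
    case False
    then have "D \<sigma> z = 0" for \<sigma> using m by (auto simp: D_def in_simplex_iff)
    then show ?thesis using False by (simp add: simplex_moment_def)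
  qed
  have int: "(\<integral>\<^sup>+z. ennreal (D \<sigma> z) \<partial>Pi\<^sub>M {1..<m} (\<lambda>_. lborel)) =
      ennreal ((\<Prod>g\<in>?M. fact (c \<sigma> g)) / fact (m - 1 + card B))" if "\<sigma> \<in> ?S" for \<sigma>
  proof -
    \<comment> \<open>The fibres partition \<open>B\<close>, so the total degree, and with it the
      denominator, is the same for every \<open>\<sigma>\<close>.\<close>
    have "sum (c \<sigma>) ?M = card B"
      unfolding c_def using finB S[OF that] by (intro sum_card_fibres) auto
    then have "card {1..<m} + sum (c \<sigma>) {1..<m} + c \<sigma> m = m - 1 + card B"
      using m by (simp add: atLeastAtMost_insert_last)
    moreover have "(\<Prod>g\<in>{1..<m}. fact (c \<sigma> g)) * fact (c \<sigma> m) = (\<Prod>g\<in>?M. fact (c \<sigma> g) :: real)"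
      using m by (simp add: atLeastAtMost_insert_last mult.commute)
    ultimately show ?thesis
      using nn_integral_dirichlet[of "{1..<m}" 1 "c \<sigma>" "c \<sigma> m", OF finite_atLeastLessThan zero_le_one]
      unfolding D_def by (simp only: power_one mult_1_right)
  qed
  have "(\<integral>\<^sup>+z. ennreal (simplex_moment m B z) \<partial>Pi\<^sub>M {1..<m} (\<lambda>_. lborel)) =
      (\<integral>\<^sup>+z. (\<Sum>\<sigma>\<in>?S. ennreal (D \<sigma> z)) \<partial>Pi\<^sub>M {1..<m} (\<lambda>_. lborel))"
    unfolding expand using Dn by (simp add: sum_ennreal)
  also have "\<dots> = (\<Sum>\<sigma>\<in>?S. \<integral>\<^sup>+z. ennreal (D \<sigma> z) \<partial>Pi\<^sub>M {1..<m} (\<lambda>_. lborel))"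
    by (intro nn_integral_sum) measurable
  also have "\<dots> = (\<Sum>\<sigma>\<in>?S. ennreal ((\<Prod>g\<in>?M. fact (c \<sigma> g)) / fact (m - 1 + card B)))"
    using int by (intro sum.cong) auto
  also have "\<dots> = ennreal (\<Sum>\<sigma>\<in>?S. (\<Prod>g\<in>?M. fact (c \<sigma> g)) / fact (m - 1 + card B))"
    by (intro sum_ennreal) (auto intro!: divide_nonneg_nonneg prod_nonneg)
  also have "(\<Sum>\<sigma>\<in>?S. (\<Prod>g\<in>?M. fact (c \<sigma> g)) / fact (m - 1 + card B)) = p m (card B) / fact (m - 1)"
    unfolding p_def W_card[OF B] c_def by (simp add: sum_divide_distrib)
  finally show ?thesis .
qed

section \<open>The volume as an integral over columns\<close>

definition col :: "nat \<Rightarrow> (nat \<times> nat \<Rightarrow> real) \<Rightarrow> nat \<Rightarrow> nat \<Rightarrow> real" where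
  "col m x j = (\<lambda>i\<in>{1..<m}. x (i, j))"

lemma measurable_col:
  assumes "j \<in> {1..n}"
  shows "(\<lambda>x. col m x j) \<in> Pi\<^sub>M ({1..<m} \<times> {1..n}) (\<lambda>_. lborel) \<rightarrow>\<^sub>M Pi\<^sub>M {1..<m} (\<lambda>_. lborel)"
  unfolding col_def using assms by (intro measurable_restrict measurable_component_singleton) auto

text \<open>On the demand subspace the entries of column \<open>j\<close> are the values of
  \<open>bary m (col m x j)\<close>, including the deleted one. Nonnegativity of all entries thus
  becomes membership of each column in the simplex.\<close>

lemma proj_image:
  assumes m: "1 \<le> m"
  shows "proj m n ` (weak_relaxation m n \<inter> demand m n) =
    {(x, y). x \<in> ({1..<m} \<times> {1..n}) \<rightarrow>\<^sub>E UNIV \<and> y \<in> {1..m} \<rightarrow>\<^sub>E UNIV \<and>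
       (\<forall>j\<in>{1..n}. in_simplex m (col m x j)) \<and>
       (\<forall>i\<in>{1..m}. (\<Sum>j\<in>{1..n}. bary m (col m x j) i) \<le> real n * y i \<and> y i \<le> 1)}" (is "_ = ?A")
proof (intro subset_antisym subsetI)
  fix u assume "u \<in> proj m n ` (weak_relaxation m n \<inter> demand m n)"
  then obtain x y where xy: "(x, y) \<in> weak_relaxation m n" "(x, y) \<in> demand m n"
    and u: "u = (restrict x ({1..<m} \<times> {1..n}), y)" by (auto simp: proj_def)
  have b: "bary m (col m (restrict x ({1..<m} \<times> {1..n})) j) i = x (i, j)" if "j \<in> {1..n}" "i \<in> {1..m}" for i j
  proof -
    have "(\<Sum>i\<in>{1..m}. x (i, j)) = 1" using xy that by (auto simp: demand_def)
    then have "x (m, j) + (\<Sum>i\<in>{1..<m}. x (i, j)) = 1" using m by (simp add: atLeastAtMost_insert_last)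
    then show ?thesis using that by (auto simp: bary_def col_def)
  qed
  show "u \<in> ?A" using xy b unfolding u
    by (auto simp: weak_relaxation_def ambient_def in_simplex_def)
next
  fix u assume "u \<in> ?A"
  then obtain x y where u: "u = (x, y)" and x: "x \<in> ({1..<m} \<times> {1..n}) \<rightarrow>\<^sub>E UNIV" and y: "y \<in> {1..m} \<rightarrow>\<^sub>E UNIV"
    and s: "\<And>j. j \<in> {1..n} \<Longrightarrow> in_simplex m (col m x j)"
    and c: "\<And>i. i \<in> {1..m} \<Longrightarrow> (\<Sum>j\<in>{1..n}. bary m (col m x j) i) \<le> real n * y i \<and> y i \<le> 1" by blast
  \<comment> \<open>The preimage under the projection: the last row is filled in from the demand
    constraints.\<close>
  define x' where "x' = (\<lambda>(i, j)\<in>{1..m} \<times> {1..n}. bary m (col m x j) i)"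
  have x': "x' (i, j) = bary m (col m x j) i" if "i \<in> {1..m}" "j \<in> {1..n}" for i j
    using that by (simp add: x'_def)
  have "(x', y) \<in> ambient m n" using y by (auto simp: ambient_def x'_def)
  then have "(x', y) \<in> weak_relaxation m n" "(x', y) \<in> demand m n"
    using c s m bary_le_1[OF m s] sum_bary[OF m] by (auto simp: weak_relaxation_def demand_def x' in_simplex_def)
  moreover have "restrict x' ({1..<m} \<times> {1..n}) = x"
  proof
    fix e show "restrict x' ({1..<m} \<times> {1..n}) e = x e"
    proof (cases "e \<in> {1..<m} \<times> {1..n}")
      case True
      then show ?thesis by (auto simp: x' bary_def col_def)
    next
      case False
      with PiE_arb[OF x False] show ?thesis by simp
    qed
  qed
  ultimately show "u \<in> proj m n ` (weak_relaxation m n \<inter> demand m n)"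
    unfolding u by (intro image_eqI[of _ _ "(x', y)"]) (auto simp: proj_def)
qed

text \<open>For fixed feasible \<open>x\<close> the admissible \<open>y\<close> form a box whose
  side \<open>i\<close> runs from the average of row \<open>i\<close> up to 1. Tonelli's theorem
  integrates the volume of this box.\<close>

lemma emeasure_proj_image:
  assumes m: "1 \<le> m" and n: "1 \<le> n"
  shows "emeasure (coord_lebesgue m n) (proj m n ` (weak_relaxation m n \<inter> demand m n)) =
    (\<integral>\<^sup>+x. ennreal (if \<forall>j\<in>{1..n}. in_simplex m (col m x j)
        then \<Prod>i\<in>{1..m}. 1 - (\<Sum>j\<in>{1..n}. bary m (col m x j) i) / real n else 0)
      \<partial>Pi\<^sub>M ({1..<m} \<times> {1..n}) (\<lambda>_. lborel))"
proof -
  let ?X = "Pi\<^sub>M ({1..<m} \<times> {1..n}) (\<lambda>_. lborel :: real measure)" and ?Y = "Pi\<^sub>M {1..m} (\<lambda>_. lborel :: real measure)"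
  define A where "A = proj m n ` (weak_relaxation m n \<inter> demand m n)"
  define av where "av x i = (\<Sum>j\<in>{1..n}. bary m (col m x j) i) / real n" for x i
  define feas where "feas x \<longleftrightarrow> (\<forall>j\<in>{1..n}. in_simplex m (col m x j))" for x
  have [measurable]: "(\<lambda>x. av x i) \<in> borel_measurable ?X" if "i \<in> {1..m}" for i
    unfolding av_def
    by (intro borel_measurable_divide borel_measurable_sum borel_measurable_const
        measurable_compose[OF measurable_col measurable_bary] that) auto
  have [measurable]: "Measurable.pred ?X feas"
    unfolding feas_def
    by (intro pred_intros_finite measurable_compose[OF measurable_col measurable_in_simplex]) auto
  have [measurable]: "(\<lambda>u. av (fst u) i) \<in> borel_measurable (?X \<Otimes>\<^sub>M ?Y)"
    "(\<lambda>u. snd u i) \<in> borel_measurable (?X \<Otimes>\<^sub>M ?Y)" if "i \<in> {1..m}" for i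
    using that by measurable
  have [measurable]: "Measurable.pred (?X \<Otimes>\<^sub>M ?Y) (\<lambda>u. feas (fst u))"
    by measurable
  have A: "A = {u \<in> space (?X \<Otimes>\<^sub>M ?Y). feas (fst u) \<and> (\<forall>i\<in>{1..m}. av (fst u) i \<le> snd u i \<and> snd u i \<le> 1)}"
    unfolding A_def proj_image[OF m] using n
    by (auto simp: space_pair_measure space_PiM feas_def av_def divide_le_eq mult.commute)
  also have "\<dots> \<in> sets (?X \<Otimes>\<^sub>M ?Y)"
    by measurable
  finally have Am: "A \<in> sets (?X \<Otimes>\<^sub>M ?Y)" .
  have slice: "emeasure ?Y (Pair x -` A) = ennreal (if feas x then \<Prod>i\<in>{1..m}. 1 - av x i else 0)"
    if x: "x \<in> space ?X" for x
  proof (cases "feas x")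
    case True
    \<comment> \<open>An average of numbers at most 1 is at most 1, so the sides have nonnegative
      length.\<close>
    have le: "av x i \<le> 1" if "i \<in> {1..m}" for i
    proof -
      have "(\<Sum>j\<in>{1..n}. bary m (col m x j) i) \<le> (\<Sum>j\<in>{1..n}. 1)"
        using True that m by (intro sum_mono bary_le_1) (auto simp: feas_def)
      then show ?thesis using n by (simp add: av_def divide_le_eq)
    qed
    have "Pair x -` A = Pi\<^sub>E {1..m} (\<lambda>i. {av x i..1})"
      using x True unfolding A by (auto simp: space_pair_measure space_PiM PiE_def Pi_def)
    then have "emeasure ?Y (Pair x -` A) = (\<Prod>i\<in>{1..m}. emeasure lborel {av x i..1})"
      by (simp add: lborel_prod.emeasure_PiM)
    also have "\<dots> = (\<Prod>i\<in>{1..m}. ennreal (1 - av x i))"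
      using le by (intro prod.cong) auto
    also have "\<dots> = ennreal (\<Prod>i\<in>{1..m}. 1 - av x i)"
      using le by (intro prod_ennreal) auto
    finally show ?thesis using True by simp
  next
    case False
    then have "Pair x -` A = {}" unfolding A by auto
    then show ?thesis using False by simp
  qed
  interpret Y: sigma_finite_measure ?Y
    by (rule lborel_prod.sigma_finite) simp
  \<comment> \<open>Completion does not change the measure of a set that is already measurable for
    the product.\<close>
  have "emeasure (coord_lebesgue m n) A = emeasure (?X \<Otimes>\<^sub>M ?Y) A"
    unfolding coord_lebesgue_def using Am by simp
  also have "\<dots> = (\<integral>\<^sup>+x. emeasure ?Y (Pair x -` A) \<partial>?X)"
    by (rule Y.emeasure_pair_measure_alt[OF Am])
  also have "\<dots> = (\<integral>\<^sup>+x. ennreal (if feas x then \<Prod>i\<in>{1..m}. 1 - av x i else 0) \<partial>?X)"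
    by (intro nn_integral_cong slice)
  finally show ?thesis unfolding A_def av_def feas_def .
qed

section \<open>The volume formula\<close>

lemma p_nonneg: "0 \<le> p m t"
  by (simp add: p_def)

text \<open>Each map \<open>\<tau>\<close> picks a column for every row. Its summand is evaluated by
  \<open>nn_integral_prod_columns\<close>, and \<open>sum_functions_by_kernel\<close> with
  \<open>h = p m\<close> collects the results by partitions.\<close>

lemma volume_formula:
  assumes m: "1 \<le> m" and n: "1 \<le> n"
  shows "fact (m - 1) ^ n * Vol m n (weak_relaxation m n \<inter> demand m n) =
    (\<Sum>P | partition_on {1..m} P. falling n (card P) / real n ^ m * (\<Prod>B\<in>P. p m (card B)))"
proof -
  let ?X = "Pi\<^sub>M ({1..<m} \<times> {1..n}) (\<lambda>_. lborel :: real measure)"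
  let ?T = "{1..m} \<rightarrow>\<^sub>E {1..n}"
  define fib where "fib \<tau> j = {i \<in> {1..m}. \<tau> i = j}" for \<tau> :: "nat \<Rightarrow> nat" and j
  have fib: "fib \<tau> j \<subseteq> {1..m}" for \<tau> j by (auto simp: fib_def)
  define G where "G \<tau> x = (\<Prod>j\<in>{1..n}. ennreal (simplex_moment m (fib \<tau> j) (col m x j)))" for \<tau> x
  have Gm: "G \<tau> \<in> borel_measurable ?X" for \<tau>
    unfolding G_def
    by (intro borel_measurable_prod_ennreal measurable_compose[OF _ measurable_ennreal]
        measurable_compose[OF measurable_col measurable_simplex_moment] fib) auto
  have expand: "ennreal (if \<forall>j\<in>{1..n}. in_simplex m (col m x j)
        then \<Prod>i\<in>{1..m}. 1 - (\<Sum>j\<in>{1..n}. bary m (col m x j) i) / real n else 0) =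
      (\<Sum>\<tau>\<in>?T. ennreal (1 / real n ^ m) * G \<tau> x)" for x
  proof (cases "\<forall>j\<in>{1..n}. in_simplex m (col m x j)")
    case True
    let ?b = "\<lambda>i j. 1 - bary m (col m x j) i"
    have nn: "0 \<le> ?b i j" if "i \<in> {1..m}" "j \<in> {1..n}" for i j
      using True that bary_le_1[OF m] by auto
    have "(\<Prod>i\<in>{1..m}. 1 - (\<Sum>j\<in>{1..n}. bary m (col m x j) i) / real n) =
       (\<Prod>i\<in>{1..m}. \<Sum>j\<in>{1..n}. ?b i j / real n)"
    \<comment> \<open>Since \<open>n \<ge> 1\<close>, the constant 1 is the average of
      \<open>n\<close> ones, so one minus an average is the average of the differences.\<close>
    proof (rule prod.cong[OF refl])
      fix i
      show "1 - (\<Sum>j\<in>{1..n}. bary m (col m x j) i) / real n = (\<Sum>j\<in>{1..n}. ?b i j / real n)"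
        using n by (simp add: sum_divide_distrib[symmetric] sum_subtractf diff_divide_distrib)
    qed
    also have "\<dots> = (\<Sum>\<tau>\<in>?T. \<Prod>i\<in>{1..m}. ?b i (\<tau> i) / real n)"
      by (intro prod_sum_PiE) auto
    also have "\<dots> = (\<Sum>\<tau>\<in>?T. 1 / real n ^ m * (\<Prod>j\<in>{1..n}. \<Prod>i\<in>fib \<tau> j. ?b i j))"
    proof (rule sum.cong[OF refl])
      fix \<tau> assume t: "\<tau> \<in> ?T"
      have "(\<Prod>i\<in>{1..m}. ?b i (\<tau> i)) = (\<Prod>j\<in>{1..n}. \<Prod>i\<in>fib \<tau> j. ?b i (\<tau> i))"
        unfolding fib_def using t by (intro prod.group[symmetric]) auto
      also have "\<dots> = (\<Prod>j\<in>{1..n}. \<Prod>i\<in>fib \<tau> j. ?b i j)"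
        by (intro prod.cong refl) (auto simp: fib_def)
      finally show "(\<Prod>i\<in>{1..m}. ?b i (\<tau> i) / real n) = 1 / real n ^ m * (\<Prod>j\<in>{1..n}. \<Prod>i\<in>fib \<tau> j. ?b i j)"
        by (simp add: prod_dividef)
    qed
    finally have "ennreal (\<Prod>i\<in>{1..m}. 1 - (\<Sum>j\<in>{1..n}. bary m (col m x j) i) / real n) =
        ennreal (\<Sum>\<tau>\<in>?T. 1 / real n ^ m * (\<Prod>j\<in>{1..n}. \<Prod>i\<in>fib \<tau> j. ?b i j))"
      by (rule arg_cong)
    also have "\<dots> = (\<Sum>\<tau>\<in>?T. ennreal (1 / real n ^ m * (\<Prod>j\<in>{1..n}. \<Prod>i\<in>fib \<tau> j. ?b i j)))"
      by (intro sum_ennreal[symmetric] mult_nonneg_nonneg prod_nonneg nn) (auto simp: fib_def)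
    also have "\<dots> = (\<Sum>\<tau>\<in>?T. ennreal (1 / real n ^ m) * G \<tau> x)"
    proof (rule sum.cong[OF refl])
      fix \<tau>
      have "G \<tau> x = ennreal (\<Prod>j\<in>{1..n}. simplex_moment m (fib \<tau> j) (col m x j))"
        unfolding G_def by (rule prod_ennreal) (rule simplex_moment_nonneg[OF m fib])
      also have "(\<Prod>j\<in>{1..n}. simplex_moment m (fib \<tau> j) (col m x j)) = (\<Prod>j\<in>{1..n}. \<Prod>i\<in>fib \<tau> j. ?b i j)"
        using True by (intro prod.cong refl) (simp add: simplex_moment_def)
      finally have G: "G \<tau> x = ennreal (\<Prod>j\<in>{1..n}. \<Prod>i\<in>fib \<tau> j. ?b i j)" .
      show "ennreal (1 / real n ^ m * (\<Prod>j\<in>{1..n}. \<Prod>i\<in>fib \<tau> j. ?b i j)) = ennreal (1 / real n ^ m) * G \<tau> x"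
        unfolding G by (intro ennreal_mult prod_nonneg nn) (auto simp: fib_def)
    qed
    finally show ?thesis using True by simp
  next
    case False
    then obtain j where "j \<in> {1..n}" "\<not> in_simplex m (col m x j)" by auto
    \<comment> \<open>The factor of an infeasible column vanishes even if its fibre is empty,
      because \<open>simplex_moment\<close> contains the indicator of the simplex.\<close>
    then have "G \<tau> x = 0" for \<tau>
      unfolding G_def by (intro prod_zero) (auto simp: simplex_moment_def)
    then show ?thesis using False by auto
  qed
  have int: "(\<integral>\<^sup>+x. G \<tau> x \<partial>?X) = ennreal ((\<Prod>j\<in>{1..n}. p m (card (fib \<tau> j))) / fact (m - 1) ^ n)" for \<tau>
  proof -
    have "(\<integral>\<^sup>+x. G \<tau> x \<partial>?X) =
        (\<Prod>j\<in>{1..n}. \<integral>\<^sup>+z. ennreal (simplex_moment m (fib \<tau> j) z) \<partial>Pi\<^sub>M {1..<m} (\<lambda>_. lborel))"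
      unfolding G_def col_def
      by (intro nn_integral_prod_columns measurable_compose[OF _ measurable_ennreal] measurable_simplex_moment fib) auto
    also have "\<dots> = (\<Prod>j\<in>{1..n}. ennreal (p m (card (fib \<tau> j)) / fact (m - 1)))"
      using m fib by (intro prod.cong nn_integral_simplex_moment) auto
    also have "\<dots> = ennreal (\<Prod>j\<in>{1..n}. p m (card (fib \<tau> j)) / fact (m - 1))"
      by (intro prod_ennreal) (simp add: p_nonneg)
    finally show ?thesis by (simp add: prod_dividef)
  qed
  let ?R = "\<Sum>\<tau>\<in>?T. 1 / real n ^ m * ((\<Prod>j\<in>{1..n}. p m (card (fib \<tau> j))) / fact (m - 1) ^ n)"
  have "emeasure (coord_lebesgue m n) (proj m n ` (weak_relaxation m n \<inter> demand m n)) =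
      (\<integral>\<^sup>+x. (\<Sum>\<tau>\<in>?T. ennreal (1 / real n ^ m) * G \<tau> x) \<partial>?X)"
    unfolding emeasure_proj_image[OF m n] expand ..
  also have "\<dots> = (\<Sum>\<tau>\<in>?T. \<integral>\<^sup>+x. ennreal (1 / real n ^ m) * G \<tau> x \<partial>?X)"
    by (intro nn_integral_sum borel_measurable_times_ennreal borel_measurable_const Gm)
  also have "\<dots> = (\<Sum>\<tau>\<in>?T. ennreal (1 / real n ^ m) * (\<integral>\<^sup>+x. G \<tau> x \<partial>?X))"
    by (intro sum.cong refl nn_integral_cmult Gm)
  also have "\<dots> = (\<Sum>\<tau>\<in>?T. ennreal (1 / real n ^ m * ((\<Prod>j\<in>{1..n}. p m (card (fib \<tau> j))) / fact (m - 1) ^ n)))"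
    unfolding int by (intro sum.cong refl ennreal_mult[symmetric] divide_nonneg_nonneg prod_nonneg) (auto simp: p_nonneg)
  also have "\<dots> = ennreal ?R"
    by (intro sum_ennreal mult_nonneg_nonneg divide_nonneg_nonneg prod_nonneg) (auto simp: p_nonneg)
  finally have em: "emeasure (coord_lebesgue m n) (proj m n ` (weak_relaxation m n \<inter> demand m n)) = ennreal ?R" .
  have "0 \<le> ?R"
    by (intro sum_nonneg mult_nonneg_nonneg divide_nonneg_nonneg prod_nonneg) (auto simp: p_nonneg)
  from measure_eq_emeasure_eq_ennreal[OF this em]
  have "Vol m n (weak_relaxation m n \<inter> demand m n) = ?R"
    unfolding Vol_def .
  \<comment> \<open>Each of the \<open>n\<close> columns contributed one factor
    \<open>1 / fact (m - 1)\<close>, which the normalisation cancels.\<close>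
  then have "fact (m - 1) ^ n * Vol m n (weak_relaxation m n \<inter> demand m n) =
      (\<Sum>\<tau>\<in>?T. \<Prod>j\<in>{1..n}. p m (card (fib \<tau> j))) / real n ^ m"
    by (simp add: sum_distrib_left sum_divide_distrib)
  also have "(\<Sum>\<tau>\<in>?T. \<Prod>j\<in>{1..n}. p m (card (fib \<tau> j))) =
     (\<Sum>P | partition_on {1..m} P. falling n (card P) * (\<Prod>B\<in>P. p m (card B)))"
    unfolding fib_def using sum_functions_by_kernel[of "{1..m}" "{1..n}" "p m"] by (simp add: p_0)
  finally show ?thesis by (simp add: sum_divide_distrib)
qed

section \<open>Polynomial dependence on \<open>1 / n\<close>\<close>

lemma falling_over_power:
  assumes "1 \<le> l" "l \<le> m"
  shows "\<exists>q :: real poly. degree q \<le> m - 1 \<and> (\<forall>n\<ge>1. falling n l / real n ^ m = poly q (1 / real n))"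
proof (intro exI conjI allI impI)
  \<comment> \<open>Dividing each of the \<open>l\<close> factors \<open>n - i\<close> by
    \<open>n\<close> gives \<open>1 - i / n\<close>, and \<open>m - l\<close> powers of
    \<open>1 / n\<close> remain.\<close>
  let ?q = "monom 1 (m - l) * (\<Prod>i<l. [:1, - real i:])"
  have "degree (\<Prod>i<l. [:1, - real i:]) \<le> (\<Sum>i<l. degree [:1, - real i:])"
    using degree_prod_sum_le[of "{..<l}" "\<lambda>i. [:1, - real i:]"] by (simp add: o_def)
  \<comment> \<open>The factor for \<open>i = 0\<close> is the constant 1. This saves one degree and
    yields the bound \<open>m - 1\<close> instead of \<open>m\<close>.\<close>
  also have "\<dots> \<le> (\<Sum>i<l. if i = 0 then 0 else 1)"
    by (intro sum_mono) auto
  also have "\<dots> = card ({..<l} - {0})"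
    by (simp add: sum.If_cases Collect_neg_eq Diff_eq)
  also have "\<dots> = l - 1" using assms by simp
  finally have "degree ?q \<le> (m - l) + (l - 1)"
    by (intro order.trans[OF degree_mult_le] add_mono) (auto simp: degree_monom_le)
  then show "degree ?q \<le> m - 1" using assms by simp
  fix n :: nat assume n: "1 \<le> n"
  have "poly (\<Prod>i<l. [:1, - real i:]) (1 / real n) = (\<Prod>i<l. (real n - real i) / real n)"
    unfolding poly_prod using n by (intro prod.cong) (auto simp: field_simps)
  also have "\<dots> = falling n l / real n ^ l" by (simp add: prod_dividef falling_def)
  finally have "poly ?q (1 / real n) = falling n l / (real n ^ (m - l) * real n ^ l)"
    by (simp add: poly_monom power_one_over)
  also have "\<dots> = falling n l / real n ^ m" using assms by (simp add: power_add[symmetric])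
  finally show "falling n l / real n ^ m = poly ?q (1 / real n)" by simp
qed

text \<open>Disjoint nonempty blocks each use up at least one element. The bounds make
  \<open>falling_over_power\<close> applicable to \<open>l = card P\<close>.\<close>

lemma card_partition_bounds:
  assumes "finite A" "A \<noteq> {}" "partition_on A P"
  shows "1 \<le> card P" "card P \<le> card A"
proof -
  have fin: "finite P" using finite_elements assms(1,3) .
  have "P \<noteq> {}" using assms by (auto simp: partition_on_def)
  then show "1 \<le> card P" using fin by (simp add: Suc_le_eq card_gt_0_iff)
  have sub: "B \<subseteq> A" "B \<noteq> {}" if "B \<in> P" for B using that assms(3) by (auto simp: partition_on_def)
  have "card P = (\<Sum>B\<in>P. 1)" by simp
  also have "\<dots> \<le> (\<Sum>B\<in>P. card B)"
    using sub assms(1) by (intro sum_mono) (metis One_nat_def Suc_leI card_gt_0_iff finite_subset)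
  also have "\<dots> = card (\<Union>P)"
    using assms sub by (intro card_Union_disjoint[symmetric]) (auto simp: partition_on_def disjoint_def pairwise_def disjnt_def intro: finite_subset)
  also have "\<Union>P = A" using assms by (simp add: partition_on_def)
  finally show "card P \<le> card A" .
qed

theorem theorem3:
  fixes m :: nat
  assumes "m \<ge> 2"
  shows "(\<forall>n::nat. n \<ge> 1 \<longrightarrow>
            fact (m - 1) ^ n * Vol m n (weak_relaxation m n \<inter> demand m n) =
            (\<Sum>P | partition_on {1..m} P. falling n (card P) / real n ^ m * (\<Prod>B\<in>P. p m (card B))))
       \<and> (\<exists>q :: real poly. degree q \<le> m - 1 \<and>
            (\<forall>n::nat. n \<ge> 1 \<longrightarrow>
               fact (m - 1) ^ n * Vol m n (weak_relaxation m n \<inter> demand m n) = poly q (1 / real n)))"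
proof -
  have vol: "fact (m - 1) ^ n * Vol m n (weak_relaxation m n \<inter> demand m n) =
      (\<Sum>P | partition_on {1..m} P. falling n (card P) / real n ^ m * (\<Prod>B\<in>P. p m (card B)))"
    if "n \<ge> 1" for n
    using assms that by (intro volume_formula) auto
  have "\<forall>P\<in>{P. partition_on {1..m} P}. \<exists>q :: real poly. degree q \<le> m - 1 \<and>
      (\<forall>n\<ge>1. falling n (card P) / real n ^ m = poly q (1 / real n))"
    using card_partition_bounds[of "{1..m}"] assms by (intro ballI falling_over_power) auto
  then obtain q :: "nat set set \<Rightarrow> real poly" where q: "\<And>P. partition_on {1..m} P \<Longrightarrow> degree (q P) \<le> m - 1"
    "\<And>P n. partition_on {1..m} P \<Longrightarrow> n \<ge> 1 \<Longrightarrow> falling n (card P) / real n ^ m = poly (q P) (1 / real n)"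
    by (metis mem_Collect_eq)
  \<comment> \<open>The products of the \<open>p m (card B)\<close> do not depend on
    \<open>n\<close>, so they serve as coefficients of a finite linear combination of the
    polynomials \<open>q P\<close>.\<close>
  let ?q = "\<Sum>P | partition_on {1..m} P. smult (\<Prod>B\<in>P. p m (card B)) (q P)"
  have "degree ?q \<le> m - 1"
    using q(1) by (intro degree_sum_le finitely_many_partition_on)
      (auto intro: order.trans[OF degree_smult_le])
  moreover have "fact (m - 1) ^ n * Vol m n (weak_relaxation m n \<inter> demand m n) = poly ?q (1 / real n)"
    if "n \<ge> 1" for n
    unfolding vol[OF that] poly_sum using q(2)[OF _ that] by (intro sum.cong) (auto simp: mult.commute)
  ultimately show ?thesis using vol by blast
qed

end
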